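(* Let $V,b:\mathbb{T}\to\mathbb{R}$ be smooth, let $N\in\mathbb{N}$ and $\gamma>0$. Then the minimization problem $$\min_{u^N\in\mathcal{G}^N,\ m^N\in\mathcal{G}^N,\ \overline{H}^N\in\mathbb{R}}J_\gamma(u^N,m^N,\overline{H}^N)$$ admits a minimizer.
   Context: $\mathbb{T}$ is the one-dimensional torus, identified with $[0,1)$. $H(x,p):=V(x)+\frac{p^2}{2}+b(x)p$. The Fourier features space is $$\mathcal{G}^N=\Big\{\phi\ \Big|\ \phi(x)=c+\sum_{i=1}^N\alpha_i\sin(2\pi ix)+\sum_{i=1}^N\beta_i\cos(2\pi ix),\ c,\alpha_i,\beta_i\in\mathbb{R}\Big\}.$$ The functional is $$J_\gamma(u,m,\overline{H})=\int_{\mathbb{T}}|u|^2dx+\int_{\mathbb{T}}|m|^2dx+\overline{H}^2+\gamma\,\mathcal{Q}(u,m,\overline{H}),$$ $$\mathcal{Q}(u,m,\overline{H})=\int_{\mathbb{T}}|e^{H(x,u_x)-\overline{H}}-m|^2dx+\Big|\int_{\mathbb{T}}u\,dx\Big|^2+\Big|\int_{\mathbb{T}}m\,dx-1\Big|^2+\int_{\mathbb{T}}|m(u_{xx}+b_x(x))+m_x(u_x+b(x))|^2dx.$$ *)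

theory Defs
  imports "HOL-Analysis.Analysis"
begin

text \<open>
  Functions on the torus are represented by their 1-periodic lifts to the real line
  (predicate \<^const>\<open>periodic_fun_simple'\<close>), and
  integrals over the torus by integrals over one closed period.
\<close>

definition smooth :: "(real \<Rightarrow> real) \<Rightarrow> bool" where
  "smooth f \<longleftrightarrow> (\<forall>k x. (deriv ^^ k) f differentiable (at x))"

definition torus_integral :: "(real \<Rightarrow> real) \<Rightarrow> real" where
  "torus_integral f = integral {0..1} f"

definition fourier_space :: "nat \<Rightarrow> (real \<Rightarrow> real) set" where
  "fourier_space N = {\<phi>. \<exists>(c::real) (\<alpha>::nat \<Rightarrow> real) (\<beta>::nat \<Rightarrow> real).
     \<forall>x. \<phi> x = c + (\<Sum>i=1..N. \<alpha> i * sin (2 * pi * real i * x))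
                + (\<Sum>i=1..N. \<beta> i * cos (2 * pi * real i * x))}"

definition hamiltonian :: "(real \<Rightarrow> real) \<Rightarrow> (real \<Rightarrow> real) \<Rightarrow> real \<Rightarrow> real \<Rightarrow> real" where
  "hamiltonian V b x p = V x + p\<^sup>2 / 2 + b x * p"

definition Q_functional ::
  "(real \<Rightarrow> real) \<Rightarrow> (real \<Rightarrow> real) \<Rightarrow> (real \<Rightarrow> real) \<Rightarrow> (real \<Rightarrow> real) \<Rightarrow> real \<Rightarrow> real" where
  "Q_functional V b u m Hbar =
     torus_integral (\<lambda>x. \<bar>exp (hamiltonian V b x (deriv u x) - Hbar) - m x\<bar>\<^sup>2)
     + \<bar>torus_integral u\<bar>\<^sup>2
     + \<bar>torus_integral m - 1\<bar>\<^sup>2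
     + torus_integral (\<lambda>x. \<bar>m x * (deriv (deriv u) x + deriv b x)
                           + deriv m x * (deriv u x + b x)\<bar>\<^sup>2)"

definition J_functional ::
  "(real \<Rightarrow> real) \<Rightarrow> (real \<Rightarrow> real) \<Rightarrow> real \<Rightarrow> (real \<Rightarrow> real) \<Rightarrow> (real \<Rightarrow> real) \<Rightarrow> real \<Rightarrow> real" where
  "J_functional V b \<gamma> u m Hbar =
     torus_integral (\<lambda>x. \<bar>u x\<bar>\<^sup>2) + torus_integral (\<lambda>x. \<bar>m x\<bar>\<^sup>2) + Hbar\<^sup>2
     + \<gamma> * Q_functional V b u m Hbar"

end

theory Submission
  imports Defs
begin

text \<open>
  The problem is finite-dimensional, so it suffices that the functional, read as a function of
  the Fourier coefficients and the constant, is continuous and has bounded sublevel sets; the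
  Weierstrass extreme value theorem then applies.

  The coefficients are taken with respect to the Hartley functions
  \<open>cos (2\<pi>kx) + sin (2\<pi>kx)\<close>, \<open>-N \<le> k \<le> N\<close>. They span the same space as the sines, cosines and
  constants, but form a single orthonormal family over which differentiation acts as the
  weighted reflection \<open>(a\<^sub>k) \<mapsto> (- 2\<pi>k a\<^sub>-\<^sub>k)\<close>. A pair \<open>(u, m)\<close> and all the derivatives in the
  functional thereby become Hartley sums of continuously varying coefficients
  (\<open>deriv_hartley_sum\<close>), and continuity follows from continuous dependence of integrals on
  parameters (\<open>continuous_on_J_functional\<close>).

  For the sublevel sets, the penalty term \<open>\<gamma> \<Q>\<close> is nonnegative, and by Parseval the two
  \<open>L\<^sup>2\<close> norms are sums of squared coefficients. Hence a competitor at least as good as the zero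
  triple has all its coefficients and its constant in \<open>[-R, R]\<close>, where \<open>R\<^sup>2\<close> is the value at the zero triple
  (\<open>J_functional_coercive\<close>). A minimizer over this box is therefore a global one.
\<close>

section \<open>The Hartley basis\<close>

definition hartley :: "int \<Rightarrow> real \<Rightarrow> real" where
  "hartley k x = cos (2 * pi * of_int k * x) + sin (2 * pi * of_int k * x)"

text \<open>
  Coefficients are indexed by all of \<open>int\<close> so that their type carries the product topology and
  does not vary with \<open>N\<close>.
\<close>
definition hartley_sum :: "nat \<Rightarrow> (int \<Rightarrow> real) \<Rightarrow> real \<Rightarrow> real" where
  "hartley_sum N a x = (\<Sum>k\<in>{- int N..int N}. a k * hartley k x)"

lemma sum_int_symmetric_interval:
  fixes f :: "int \<Rightarrow> 'a::comm_monoid_add"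
  shows "(\<Sum>k\<in>{- int N..int N}. f k) = f 0 + (\<Sum>i=1..N. f (int i) + f (- int i))"
proof (induction N)
  case (Suc N)
  have "{- int (Suc N)..int (Suc N)}
      = insert (int (Suc N)) (insert (- int (Suc N)) {- int N..int N})"
    by auto
  then show ?case
    using Suc.IH by (simp add: ac_simps)
qed simp

lemma hartley_sum_split:
  "hartley_sum N a x =
     a 0 + (\<Sum>i=1..N. (a (int i) - a (- int i)) * sin (2 * pi * real i * x))
         + (\<Sum>i=1..N. (a (int i) + a (- int i)) * cos (2 * pi * real i * x))"
  unfolding hartley_sum_def sum_int_symmetric_interval
  by (simp add: hartley_def sum.distrib[symmetric] algebra_simps)

lemma hartley_sum_in_fourier_space: "hartley_sum N a \<in> fourier_space N"
  unfolding fourier_space_def mem_Collect_eq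
  by (intro exI allI) (rule hartley_sum_split)

text \<open>
  The coefficients outside \<open>{-N..N}\<close> are chosen to vanish, so that bounds on those inside place
  the whole coefficient function in a box.
\<close>
lemma fourier_space_hartley_sumE:
  assumes "\<phi> \<in> fourier_space N"
  obtains a where "\<phi> = hartley_sum N a" "\<And>k. k \<notin> {- int N..int N} \<Longrightarrow> a k = 0"
proof -
  obtain c \<alpha> \<beta> where \<phi>: "\<And>x. \<phi> x = c + (\<Sum>i=1..N. \<alpha> i * sin (2 * pi * real i * x))
      + (\<Sum>i=1..N. \<beta> i * cos (2 * pi * real i * x))"
    using assms unfolding fourier_space_def by blast
  \<comment> \<open>The solution of \<open>a\<^sub>i - a\<^sub>-\<^sub>i = \<alpha>\<^sub>i\<close>, \<open>a\<^sub>i + a\<^sub>-\<^sub>i = \<beta>\<^sub>i\<close>, as comparing sines and cosines demands.\<close>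
  define a where "a k = (if k \<notin> {- int N..int N} then 0 else if k = 0 then c
      else if k > 0 then (\<beta> (nat k) + \<alpha> (nat k)) / 2
      else (\<beta> (nat (- k)) - \<alpha> (nat (- k))) / 2)" for k
  have "a (int i) - a (- int i) = \<alpha> i" "a (int i) + a (- int i) = \<beta> i" if "i \<in> {1..N}" for i
    using that by (auto simp: a_def field_simps)
  then have "\<phi> x = hartley_sum N a x" for x
    unfolding hartley_sum_split \<phi> by (simp add: a_def)
  then show thesis
    by (intro that[of a]) (auto simp: a_def)
qed

lemma has_integral_cos_sin_period:
  fixes j :: int
  shows "((\<lambda>x. cos (2 * pi * of_int j * x)) has_integral (if j = 0 then 1 else 0)) {0..1}"
    and "((\<lambda>x. sin (2 * pi * of_int j * x)) has_integral 0) {0..1}"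
proof -
  have cos_sin: "sin (2 * pi * real_of_int j) = 0" "cos (2 * pi * real_of_int j) = 1"
    by (simp_all add: sin_integer_2pi cos_integer_2pi)
  show "((\<lambda>x. cos (2 * pi * of_int j * x)) has_integral (if j = 0 then 1 else 0)) {0..1}"
  proof (cases "j = 0")
    case True
    then show ?thesis
      using has_integral_const_real[of "1::real" 0 1] by simp
  next
    case False
    have "((\<lambda>x. cos (2 * pi * of_int j * x)) has_integral
        (sin (2 * pi * of_int j * 1) / (2 * pi * of_int j)
          - sin (2 * pi * of_int j * 0) / (2 * pi * of_int j))) {0..1::real}"
      by (rule fundamental_theorem_of_calculus)
        (use False in \<open>auto intro!: derivative_eq_intros
          simp flip: has_real_derivative_iff_has_vector_derivative\<close>)
    then show ?thesis
      using False cos_sin by simp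
  qed
  show "((\<lambda>x. sin (2 * pi * of_int j * x)) has_integral 0) {0..1}"
  proof (cases "j = 0")
    case False
    have "((\<lambda>x. sin (2 * pi * of_int j * x)) has_integral
        (- cos (2 * pi * of_int j * 1) / (2 * pi * of_int j)
          - - cos (2 * pi * of_int j * 0) / (2 * pi * of_int j))) {0..1::real}"
      by (rule fundamental_theorem_of_calculus)
        (use False in \<open>auto intro!: derivative_eq_intros
          simp flip: has_real_derivative_iff_has_vector_derivative\<close>)
    then show ?thesis
      using False cos_sin by simp
  qed simp
qed

text \<open>
  The product of two Hartley functions is \<open>cos (2\<pi>(k - l)x) + sin (2\<pi>(k + l)x)\<close>. The sine always
  integrates to zero over a period, the cosine unless its frequency vanishes.
\<close>
lemma hartley_orthonormal:
  "((\<lambda>x. hartley k x * hartley l x) has_integral (if k = l then 1 else 0)) {0..1}"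
proof -
  have "hartley k x * hartley l x
      = cos (2 * pi * of_int (k - l) * x) + sin (2 * pi * of_int (k + l) * x)" for x
    unfolding hartley_def
    by (simp add: cos_diff sin_add left_diff_distrib distrib_left distrib_right right_diff_distrib)
  then show ?thesis
    using has_integral_add[OF has_integral_cos_sin_period(1)[of "k - l"]
        has_integral_cos_sin_period(2)[of "k + l"]]
    by simp
qed

lemma parseval_hartley:
  "torus_integral (\<lambda>x. \<bar>hartley_sum N a x\<bar>\<^sup>2) = (\<Sum>k\<in>{- int N..int N}. (a k)\<^sup>2)"
proof -
  let ?I = "{- int N..int N}"
  have "((\<lambda>x. \<Sum>k\<in>?I. \<Sum>l\<in>?I. a k * a l * (hartley k x * hartley l x)) has_integral
      (\<Sum>k\<in>?I. \<Sum>l\<in>?I. a k * a l * (if k = l then 1 else 0))) {0..1}"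
    by (intro has_integral_sum has_integral_mult_right hartley_orthonormal) auto
  moreover have "(\<Sum>k\<in>?I. \<Sum>l\<in>?I. a k * a l * (hartley k x * hartley l x))
      = \<bar>hartley_sum N a x\<bar>\<^sup>2" for x
    by (simp add: hartley_sum_def power2_eq_square sum_product algebra_simps)
  moreover have "(\<Sum>k\<in>?I. \<Sum>l\<in>?I. a k * a l * (if k = l then 1 else 0))
      = (\<Sum>k\<in>?I. (a k)\<^sup>2)"
    by (intro sum.cong refl) (simp add: if_distrib power2_eq_square cong: if_cong)
  ultimately show ?thesis
    unfolding torus_integral_def by (simp add: integral_unique)
qed

section \<open>Derivatives on coefficients\<close>

text \<open>
  The derivative of the \<open>k\<close>-th Hartley function is \<open>2\<pi>k\<close> times the one of index \<open>-k\<close>; collecting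
  the terms by index moves the coefficient at \<open>-k\<close> to \<open>k\<close> and turns its factor into \<open>-2\<pi>k\<close>.
\<close>
definition hartley_deriv :: "(int \<Rightarrow> real) \<Rightarrow> int \<Rightarrow> real" where
  "hartley_deriv a k = - 2 * pi * of_int k * a (- k)"

lemma deriv_hartley_sum: "deriv (hartley_sum N a) = hartley_sum N (hartley_deriv a)"
proof
  fix x
  have "((\<lambda>x. \<Sum>k\<in>{- int N..int N}. a k * hartley k x) has_real_derivative
      (\<Sum>k\<in>{- int N..int N}. a k * (2 * pi * of_int k * hartley (- k) x))) (at x)"
    unfolding hartley_def
    by (rule DERIV_sum) (auto intro!: derivative_eq_intros simp: algebra_simps)
  also have "(\<Sum>k\<in>{- int N..int N}. a k * (2 * pi * of_int k * hartley (- k) x))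
      = hartley_sum N (hartley_deriv a) x"
    unfolding hartley_sum_def
    by (rule sum.reindex_bij_witness[where i = uminus and j = uminus])
      (auto simp: hartley_deriv_def)
  finally show "deriv (hartley_sum N a) x = hartley_sum N (hartley_deriv a) x"
    by (simp add: DERIV_imp_deriv hartley_sum_def[abs_def])
qed

section \<open>Continuity in the coefficients\<close>

lemma continuous_on_hartley_deriv:
  assumes "continuous_on A f"
  shows "continuous_on A (\<lambda>p. hartley_deriv (f p))"
  unfolding hartley_deriv_def
  by (intro continuous_intros continuous_on_product_then_coordinatewise[OF assms])

lemma continuous_on_hartley_sum:
  fixes f :: "'a::t2_space \<Rightarrow> int \<Rightarrow> real"
  assumes "continuous_on A f" "continuous_on A g"
  shows "continuous_on A (\<lambda>p. hartley_sum N (f p) (g p))"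
proof -
  have "continuous_on A (\<lambda>p. f p k)" for k
    by (rule continuous_on_product_then_coordinatewise[OF assms(1)])
  moreover have "continuous_on A (\<lambda>p. hartley k (g p))" for k
    unfolding hartley_def by (intro continuous_intros assms(2))
  ultimately show ?thesis
    unfolding hartley_sum_def by (intro continuous_on_sum continuous_on_mult)
qed

lemma continuous_on_torus_integral:
  fixes F :: "'a::topological_space \<Rightarrow> real \<Rightarrow> real"
  assumes "continuous_on UNIV (\<lambda>q. F (fst q) (snd q))"
  shows "continuous_on A (\<lambda>p. torus_integral (F p))"
proof -
  have "continuous_on (A \<times> cbox 0 1) (\<lambda>(p, x). F p x)"
    using continuous_on_subset[OF assms subset_UNIV] by (simp add: case_prod_unfold)
  from integral_continuous_on_param[OF this] show ?thesis
    by (simp add: torus_integral_def)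
qed

lemma smooth_imp_continuous_on:
  assumes "smooth f"
  shows "continuous_on A f" "continuous_on A (deriv f)"
proof -
  have "f differentiable at x" "deriv f differentiable at x" for x
    using assms[unfolded smooth_def, rule_format, of 0 x]
      assms[unfolded smooth_def, rule_format, of 1 x] by simp_all
  then show "continuous_on A f" "continuous_on A (deriv f)"
    by (auto intro!: continuous_at_imp_continuous_on differentiable_imp_continuous_within)
qed

text \<open>
  Once the derivatives are expressed through \<open>hartley_deriv\<close>, every integrand is a composition
  of functions jointly continuous in the parameters and \<open>x\<close>.
\<close>
lemma continuous_on_J_functional:
  assumes "smooth V" "smooth b"
  shows "continuous_on A (\<lambda>(a, d, h).
    J_functional V b \<gamma> (hartley_sum N a) (hartley_sum N d) h)"
proof -
  let ?P = "UNIV :: (((int \<Rightarrow> real) \<times> (int \<Rightarrow> real) \<times> real) \<times> real) set"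
  have of_x: "continuous_on ?P (\<lambda>q. f (snd q))" if "continuous_on UNIV f" for f :: "real \<Rightarrow> real"
    using continuous_on_compose2[OF that continuous_on_snd[OF continuous_on_id]] by simp
  note data = of_x[OF smooth_imp_continuous_on(1)[OF assms(1)]]
    of_x[OF smooth_imp_continuous_on(1)[OF assms(2)]]
    of_x[OF smooth_imp_continuous_on(2)[OF assms(2)]]
  \<comment> \<open>An explicit list in place of \<open>continuous_intros\<close>, whose rule for function-valued maps would
    split the coefficient functions into coordinates.\<close>
  note rules = continuous_on_add continuous_on_diff continuous_on_mult continuous_on_divide
    continuous_on_power continuous_on_rabs continuous_on_exp continuous_on_const
    continuous_on_fst continuous_on_snd continuous_on_id
    continuous_on_hartley_sum continuous_on_hartley_deriv continuous_on_torus_integral data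
  show ?thesis
    unfolding J_functional_def Q_functional_def hamiltonian_def deriv_hartley_sum case_prod_unfold
    by (intro rules) simp_all
qed

section \<open>Coercivity and existence\<close>

text \<open>A function that is not integrable has integral \<open>0\<close>.\<close>
lemma torus_integral_nonneg:
  assumes "\<And>x. 0 \<le> f x"
  shows "0 \<le> torus_integral f"
  unfolding torus_integral_def
  by (cases "f integrable_on {0..1}")
    (simp_all add: integral_nonneg assms not_integrable_integral)

text \<open>
  Each of the three squares is bounded by one summand of the functional (the first two by
  Parseval), while all the other summands are nonnegative.
\<close>
lemma J_functional_coercive:
  fixes V b :: "real \<Rightarrow> real" and a d :: "int \<Rightarrow> real" and h :: real
  assumes "\<gamma> > 0" "k \<in> {- int N..int N}"
  defines "j \<equiv> J_functional V b \<gamma> (hartley_sum N a) (hartley_sum N d) h"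
  shows "(a k)\<^sup>2 \<le> j" "(d k)\<^sup>2 \<le> j" "h\<^sup>2 \<le> j"
proof -
  have coeff: "(c k)\<^sup>2 \<le> torus_integral (\<lambda>x. \<bar>hartley_sum N c x\<bar>\<^sup>2)" for c
    unfolding parseval_hartley using assms(2) by (intro member_le_sum) auto
  have "0 \<le> Q_functional V b (hartley_sum N a) (hartley_sum N d) h"
    unfolding Q_functional_def by (intro add_nonneg_nonneg torus_integral_nonneg) simp_all
  then have "0 \<le> \<gamma> * Q_functional V b (hartley_sum N a) (hartley_sum N d) h"
    using assms(1) by simp
  with coeff[of a] coeff[of d] zero_le_power2[of "a k"] zero_le_power2[of "d k"]
    zero_le_power2[of h]
  show "(a k)\<^sup>2 \<le> j" "(d k)\<^sup>2 \<le> j" "h\<^sup>2 \<le> j"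
    unfolding j_def J_functional_def by linarith+
qed

text \<open>Tychonoff's theorem.\<close>
lemma compact_coefficient_box:
  "compact {a :: 'i \<Rightarrow> real. \<forall>k. \<bar>a k\<bar> \<le> R}"
proof -
  have "{a :: 'i \<Rightarrow> real. \<forall>k. \<bar>a k\<bar> \<le> R} = PiE UNIV (\<lambda>_. {-R..R})"
    by (auto simp: PiE_def Pi_def abs_le_iff minus_le_iff)
  moreover have "compactin (product_topology (\<lambda>_::'i. euclidean) UNIV) (PiE UNIV (\<lambda>_. {-R..R}))"
    unfolding compactin_PiE by simp
  ultimately show ?thesis
    by (simp add: euclidean_product_topology)
qed

theorem theorem2p5:
  fixes V b :: "real \<Rightarrow> real" and N :: nat and \<gamma> :: real
  assumes "periodic_fun_simple' V" and "smooth V"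
    and "periodic_fun_simple' b" and "smooth b"
    and "\<gamma> > 0"
  shows "\<exists>u\<in>fourier_space N. \<exists>m\<in>fourier_space N. \<exists>Hbar::real.
           \<forall>u'\<in>fourier_space N. \<forall>m'\<in>fourier_space N. \<forall>Hbar'::real.
             J_functional V b \<gamma> u m Hbar \<le> J_functional V b \<gamma> u' m' Hbar'"
proof -
  let ?J = "\<lambda>(a, d, h). J_functional V b \<gamma> (hartley_sum N a) (hartley_sum N d) h"
  let ?z = "(\<lambda>_. 0, \<lambda>_. 0, 0) :: (int \<Rightarrow> real) \<times> (int \<Rightarrow> real) \<times> real"
  \<comment> \<open>Coercivity bounds the squares of coefficients and constant by the functional, so every
    competitor with a value up to that of \<open>?z\<close> lies in the box of radius \<open>R\<close>.\<close>
  define R where "R = sqrt (?J ?z)"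
  define B where "B = {a :: int \<Rightarrow> real. \<forall>k. \<bar>a k\<bar> \<le> R}"
  let ?K = "B \<times> B \<times> {-R..R}"
  have "0 \<le> ?J ?z"
    using J_functional_coercive(3)[OF assms(5), of 0 N 0 V b "\<lambda>_. 0" "\<lambda>_. 0"] by simp
  then have "R \<ge> 0"
    by (simp add: R_def)
  then have z: "?z \<in> ?K"
    by (simp add: B_def)
  have "compact ?K"
    unfolding B_def by (intro compact_Times compact_coefficient_box compact_Icc)
  then obtain p where p: "p \<in> ?K" and min: "\<And>q. q \<in> ?K \<Longrightarrow> ?J p \<le> ?J q"
    using continuous_attains_inf[of ?K ?J] z continuous_on_J_functional[OF assms(2,4)] by blast
  have global: "?J p \<le> J_functional V b \<gamma> u' m' h"
    if u': "u' \<in> fourier_space N" and m': "m' \<in> fourier_space N" for u' m' h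
  proof -
    obtain a where a: "u' = hartley_sum N a" "\<And>k. k \<notin> {- int N..int N} \<Longrightarrow> a k = 0"
      using fourier_space_hartley_sumE[OF u'] by blast
    obtain d where d: "m' = hartley_sum N d" "\<And>k. k \<notin> {- int N..int N} \<Longrightarrow> d k = 0"
      using fourier_space_hartley_sumE[OF m'] by blast
    show ?thesis
    proof (cases "J_functional V b \<gamma> u' m' h \<le> ?J ?z")
      case True
      have le_R: "\<bar>t\<bar> \<le> R" if "t\<^sup>2 \<le> J_functional V b \<gamma> u' m' h" for t
        unfolding R_def using that True by (intro real_le_rsqrt) simp
      note coercive = J_functional_coercive[where N = N and V = V and b = b and a = a and d = d
          and h = h, OF assms(5), folded a(1) d(1)]
      have "\<bar>a k\<bar> \<le> R" "\<bar>d k\<bar> \<le> R" for k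
        using coercive(1,2)[THEN le_R] a(2) d(2) \<open>R \<ge> 0\<close>
        by (cases "k \<in> {- int N..int N}"; simp)+
      moreover have "\<bar>h\<bar> \<le> R"
        using coercive(3)[of 0, THEN le_R] by simp
      ultimately have "(a, d, h) \<in> ?K"
        by (simp add: B_def abs_le_iff)
      from min[OF this] show ?thesis
        by (simp add: a(1) d(1))
    next
      case False
      with min[OF z] show ?thesis by linarith
    qed
  qed
  obtain a d h where "p = (a, d, h)"
    by (cases p)
  with global show ?thesis
    by (intro bexI[of _ "hartley_sum N a"] bexI[of _ "hartley_sum N d"] exI[of _ h])
      (auto simp: hartley_sum_in_fourier_space)
qed

end
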